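(* Consider the 2-dimensional vector packing problem with normalized capacities: given $n$ items $(s_1,l_1),\dots,(s_n,l_n)$ with $s_i,l_i\in[0,1]$, partition them into bins $B_1,\dots,B_k$ such that $\sum_{(s_i,l_i)\in B_j} s_i\le 1$ and $\sum_{(s_i,l_i)\in B_j} l_i\le 1$ for every $j$, using as few bins as possible. Let $C^\ast$ be the minimum possible number of bins and $\rho=\max\{s_i,l_i : 1\le i\le n\}$. Then Algorithm Pack\_Disks (described in the context) runs in $O(n)$ time and produces a solution with at most $\frac{C^\ast}{1-\rho}+1$ bins.
   Context: An item is s-heavy if $s_i\ge l_i$ and l-heavy otherwise. For a bin with cumulative weights $S=\sum s_i$ and $L=\sum l_i$, the bin is s-complete if $1-\rho\le S\le 1$, l-complete if $1-\rho\le L\le 1$, and complete if both hold. Algorithm Pack\_Disks (an in-place algorithm on the array of items, using two forward-moving pointers to the first unassigned s-heavy item and the first unassigned l-heavy item) works as follows. A bin is opened with the first unassigned item. While there remain both unassigned s-heavy and unassigned l-heavy items: if $S\ge L$, the first unassigned l-heavy item is added to the current bin, and if this makes $S>1$ the most recently added s-heavy item of the bin is removed from the bin (it becomes unassigned again, and is placed to start the next bin); if $L>S$, symmetrically the first unassigned s-heavy item is added, and if this makes $L>1$ the most recently added l-heavy item of the bin is removed. After each such step, if $S\ge 1-\rho$ and $L\ge 1-\rho$ the current bin is closed and a new bin is opened with the next unassigned item. When the loop ends, the remaining unassigned items are all s-heavy or all l-heavy; they are packed by one-dimensional packing on the $s$-values (respectively $l$-values), filling each bin until it is s-complete (respectively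 l-complete) before starting a new bin.
   Formalization: As described, the algorithm can exceed a capacity or the bin bound. In the formal version completeness is also tested when a bin is opened, the final phase continues the open bin, and the overflow/removal rule stays in force there. The bin bound is stated for ρ<1. *)

theory Defs
  imports "HOL-Library.Landau_Symbols" "HOL-Library.Disjoint_Sets"
begin

text \<open>
  An instance has \<open>n\<close> items, named by the indices \<open>0, \<dots>, n - 1\<close>; item \<open>i\<close> is the pair \<open>(s i, l i)\<close>.
\<close>

definition valid_instance :: "nat \<Rightarrow> (nat \<Rightarrow> real) \<Rightarrow> (nat \<Rightarrow> real) \<Rightarrow> bool" where
  "valid_instance n s l \<longleftrightarrow> n \<ge> 1 \<and> (\<forall>i<n. s i \<in> {0..1} \<and> l i \<in> {0..1})"

definition packing :: "nat \<Rightarrow> (nat \<Rightarrow> real) \<Rightarrow> (nat \<Rightarrow> real) \<Rightarrow> nat set list \<Rightarrow> bool" where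
  "packing n s l Bs \<longleftrightarrow>
     partition_on {..<n} (set Bs) \<and> distinct Bs \<and> (\<forall>B\<in>set Bs. sum s B \<le> 1 \<and> sum l B \<le> 1)"

definition min_bins :: "nat \<Rightarrow> (nat \<Rightarrow> real) \<Rightarrow> (nat \<Rightarrow> real) \<Rightarrow> nat" where
  "min_bins n s l = (LEAST k. \<exists>Bs. packing n s l Bs \<and> length Bs = k)"

definition max_weight :: "nat \<Rightarrow> (nat \<Rightarrow> real) \<Rightarrow> (nat \<Rightarrow> real) \<Rightarrow> real" where
  "max_weight n s l = Max (s ` {..<n} \<union> l ` {..<n})"

text \<open>
  \<open>Pack_Disks\<close> is a machine on an array of items (represented by their indices).  One transition
  performs a bounded number of array reads and writes, pointer increments, additions and comparisons
  of reals, and pushes onto the list of closed bins, so the number of transitions is the running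
  time in the usual unit-cost model.  No transition searches the array: the pointers advance one
  cell per transition.

  The array is kept in the order: closed bins, current bin, unassigned items.  An item is put into
  the current bin by exchanging it with the first unassigned item, and an item removed from the
  current bin is moved to the front of the unassigned part.
\<close>

datatype mode = Scan | Open | Advance_S | Advance_L | Pack | Halted

record state =
  mode :: mode
  arr :: "nat list"
  scan :: nat                   \<comment> \<open>cells already inspected while computing \<open>\<rho>\<close>\<close>
  rho :: real                   \<comment> \<open>largest weight seen so far, \<open>\<rho>\<close> when the scan is over\<close>
  first :: nat                  \<comment> \<open>first cell of the current bin\<close>
  free :: nat                   \<comment> \<open>first cell of the unassigned part\<close>
  ptr_s :: nat                  \<comment> \<open>forward-moving pointer to the first unassigned s-heavy item\<close>
  ptr_l :: nat                  \<comment> \<open>forward-moving pointer to the first unassigned l-heavy item\<close>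
  last_s :: nat                 \<comment> \<open>cell of the most recently added s-heavy item of the current bin\<close>
  last_l :: nat                 \<comment> \<open>cell of the most recently added l-heavy item of the current bin\<close>
  S_sum :: real
  L_sum :: real
  closed :: "(nat \<times> nat) list" \<comment> \<open>cells \<open>a, \<dots>, b - 1\<close> of every closed bin \<open>(a, b)\<close>, latest bin first\<close>

definition swap_cells :: "nat \<Rightarrow> nat \<Rightarrow> 'a list \<Rightarrow> 'a list" where
  "swap_cells p q xs = xs[p := xs ! q, q := xs ! p]"

definition initial_state :: "nat \<Rightarrow> state" where
  "initial_state n =
     \<lparr>mode = Scan, arr = [0..<n], scan = 0, rho = 0, first = 0, free = 0, ptr_s = 0, ptr_l = 0,
      last_s = 0, last_l = 0, S_sum = 0, L_sum = 0, closed = []\<rparr>"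

definition bins_of :: "state \<Rightarrow> nat set list" where
  "bins_of \<sigma> = map (\<lambda>(a, b). (!) (arr \<sigma>) ` {a..<b}) (rev (closed \<sigma>))"

definition close_bin :: "state \<Rightarrow> state" where
  "close_bin \<sigma> = \<sigma>\<lparr>closed := (first \<sigma>, free \<sigma>) # closed \<sigma>, mode := Open\<rparr>"

context
  fixes n :: nat and s l :: "nat \<Rightarrow> real"
begin

definition s_heavy :: "nat \<Rightarrow> bool" where
  "s_heavy i \<longleftrightarrow> s i \<ge> l i"

definition scan_step :: "state \<Rightarrow> state" where
  "scan_step \<sigma> =
     (if scan \<sigma> < n
      then let i = arr \<sigma> ! scan \<sigma>
           in \<sigma>\<lparr>scan := scan \<sigma> + 1, rho := max (rho \<sigma>) (max (s i) (l i))\<rparr>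
      else \<sigma>\<lparr>mode := Open\<rparr>)"

definition open_step :: "state \<Rightarrow> state" where
  "open_step \<sigma> =
     (if free \<sigma> < n
      then let i = arr \<sigma> ! free \<sigma>;
               \<sigma>' = (if s_heavy i then \<sigma>\<lparr>last_s := free \<sigma>\<rparr> else \<sigma>\<lparr>last_l := free \<sigma>\<rparr>)
           in \<sigma>'\<lparr>first := free \<sigma>, free := free \<sigma> + 1, S_sum := s i, L_sum := l i, mode := Advance_S\<rparr>
      else \<sigma>\<lparr>mode := Halted\<rparr>)"

definition advance_s_step :: "state \<Rightarrow> state" where
  "advance_s_step \<sigma> =
     (if ptr_s \<sigma> < n \<and> (ptr_s \<sigma> < free \<sigma> \<or> \<not> s_heavy (arr \<sigma> ! ptr_s \<sigma>))
      then \<sigma>\<lparr>ptr_s := ptr_s \<sigma> + 1\<rparr>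
      else \<sigma>\<lparr>mode := Advance_L\<rparr>)"

definition advance_l_step :: "state \<Rightarrow> state" where
  "advance_l_step \<sigma> =
     (if ptr_l \<sigma> < n \<and> (ptr_l \<sigma> < free \<sigma> \<or> s_heavy (arr \<sigma> ! ptr_l \<sigma>))
      then \<sigma>\<lparr>ptr_l := ptr_l \<sigma> + 1\<rparr>
      else \<sigma>\<lparr>mode := Pack\<rparr>)"

text \<open>
  On overflow the added item takes the cell of the removed one, and the removed one is put into the
  first unassigned cell.  It has to start the next bin, so the current bin is closed at once (the
  remaining bin is in fact always complete).
\<close>

definition add_s :: "state \<Rightarrow> state" where
  "add_s \<sigma> =
     (let i = arr \<sigma> ! ptr_s \<sigma>;
          \<sigma>' = \<sigma>\<lparr>arr := swap_cells (ptr_s \<sigma>) (free \<sigma>) (arr \<sigma>),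
                 S_sum := S_sum \<sigma> + s i, L_sum := L_sum \<sigma> + l i\<rparr>
      in if L_sum \<sigma>' > 1
         then close_bin (\<sigma>'\<lparr>arr := swap_cells (last_l \<sigma>') (free \<sigma>') (arr \<sigma>')\<rparr>)
         else \<sigma>'\<lparr>last_s := free \<sigma>', free := free \<sigma>' + 1, mode := Advance_S\<rparr>)"

definition add_l :: "state \<Rightarrow> state" where
  "add_l \<sigma> =
     (let i = arr \<sigma> ! ptr_l \<sigma>;
          \<sigma>' = \<sigma>\<lparr>arr := swap_cells (ptr_l \<sigma>) (free \<sigma>) (arr \<sigma>),
                 S_sum := S_sum \<sigma> + s i, L_sum := L_sum \<sigma> + l i\<rparr>
      in if S_sum \<sigma>' > 1
         then close_bin (\<sigma>'\<lparr>arr := swap_cells (last_s \<sigma>') (free \<sigma>') (arr \<sigma>')\<rparr>)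
         else \<sigma>'\<lparr>last_l := free \<sigma>', free := free \<sigma>' + 1, mode := Advance_S\<rparr>)"

text \<open>
  A pointer equal to \<open>n\<close> means that no unassigned item of its kind is left.  A bin is tested for
  completeness after it is opened as well as after every addition: for \<open>\<rho> > 1/2\<close> a single item can
  be complete, and adding to it could exceed a capacity.  The second branch is the body of the main
  loop; the following ones are the final one-dimensional packing, which continues with the bin left
  open by the loop.  The overflow rule stays in force there: in a bin with items of both kinds,
  filling up one coordinate could exceed the other capacity.  It never applies to a bin with items
  of one kind only.
\<close>

definition pack_step :: "state \<Rightarrow> state" where
  "pack_step \<sigma> =
     (if S_sum \<sigma> \<ge> 1 - rho \<sigma> \<and> L_sum \<sigma> \<ge> 1 - rho \<sigma> then close_bin \<sigma>
      else if ptr_s \<sigma> < n \<and> ptr_l \<sigma> < n then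
        (if S_sum \<sigma> \<ge> L_sum \<sigma> then add_l \<sigma> else add_s \<sigma>)
      else if ptr_s \<sigma> < n then
        (if S_sum \<sigma> \<ge> 1 - rho \<sigma> then close_bin \<sigma> else add_s \<sigma>)
      else if ptr_l \<sigma> < n then
        (if L_sum \<sigma> \<ge> 1 - rho \<sigma> then close_bin \<sigma> else add_l \<sigma>)
      else close_bin \<sigma>)"

definition step :: "state \<Rightarrow> state" where
  "step \<sigma> = (case mode \<sigma> of
       Scan \<Rightarrow> scan_step \<sigma>
     | Open \<Rightarrow> open_step \<sigma>
     | Advance_S \<Rightarrow> advance_s_step \<sigma>
     | Advance_L \<Rightarrow> advance_l_step \<sigma>
     | Pack \<Rightarrow> pack_step \<sigma>
     | Halted \<Rightarrow> \<sigma>)"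

definition pack_disks_run :: "nat \<Rightarrow> state" where
  "pack_disks_run t = (step ^^ t) (initial_state n)"

end

end

theory Submission
  imports Defs "HOL-Library.Multiset"
begin

text \<open>
  Whenever an item is added to the current bin, the lighter coordinate lies below \<open>1 - \<rho>\<close> and so
  cannot overflow.  An s-heavy item is added to a bin with \<open>S < L\<close> as long as l-heavy items are
  left, so without the most recent s-heavy item the bin has \<open>S \<le> L\<close>.  If a new l-heavy item makes
  \<open>S > 1\<close>, exchanging it for that item therefore gives \<open>1 - \<rho> < S \<le> L \<le> 1\<close>: the bin is complete.
  Hence either all bins but the last are s-complete or all bins but the last are l-complete, and the
  total weight in that coordinate bounds the optimum from below.

  The running time is linear because a potential, initially \<open>8 * n + 2\<close>, drops with every transition.
\<close>

section \<open>Cell exchanges and weights of cell ranges\<close>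

lemma swap_cells_nth:
  assumes "p < length xs" "q < length xs" "c < length xs"
  shows "swap_cells p q xs ! c = (if c = p then xs ! q else if c = q then xs ! p else xs ! c)"
  using assms by (auto simp: swap_cells_def nth_list_update)

lemma length_swap_cells [simp]: "length (swap_cells p q xs) = length xs"
  by (simp add: swap_cells_def)

lemma mset_swap_cells:
  assumes "p < length xs" "q < length xs"
  shows "mset (swap_cells p q xs) = mset xs"
  unfolding swap_cells_def by (rule mset_swap[OF assms(2,1)])

text \<open>Summing over cells instead of over the set of items makes concatenation and replacement
  exact without any appeal to distinctness of the array.\<close>

definition weight :: "('a \<Rightarrow> real) \<Rightarrow> 'a list \<Rightarrow> nat \<Rightarrow> nat \<Rightarrow> real" where
  "weight f xs a b = (\<Sum>c=a..<b. f (xs ! c))"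

lemma weight_cong: "(\<And>c. a \<le> c \<Longrightarrow> c < b \<Longrightarrow> xs ! c = ys ! c) \<Longrightarrow> weight f xs a b = weight f ys a b"
  unfolding weight_def by (intro sum.cong) auto

lemma weight_Suc: "a \<le> b \<Longrightarrow> weight f xs a (Suc b) = weight f xs a b + f (xs ! b)"
  unfolding weight_def by simp

lemma weight_replace:
  assumes "a \<le> q" "q < b" "\<And>c. a \<le> c \<Longrightarrow> c < b \<Longrightarrow> c \<noteq> q \<Longrightarrow> ys ! c = xs ! c"
  shows "weight f ys a b = weight f xs a b - f (xs ! q) + f (ys ! q)"
proof -
  have "sum (\<lambda>c. f (ys ! c)) ({a..<b} - {q}) = sum (\<lambda>c. f (xs ! c)) ({a..<b} - {q})"
    using assms by (intro sum.cong) auto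
  moreover have "q \<in> {a..<b}" using assms by auto
  ultimately show ?thesis
    unfolding weight_def by (simp add: sum.remove[of "{a..<b}" q])
qed

text \<open>Addition without overflow: both exchanged cells lie at \<open>m\<close> or beyond, so
  the range \<open>{a..<m}\<close> is untouched and cell \<open>m\<close> joins it.\<close>

lemma weight_add:
  assumes "m \<le> p" "p < length xs" "a \<le> m"
  shows "weight f (swap_cells p m xs) a (Suc m) = weight f xs a m + f (xs ! p)"
proof -
  have "weight f (swap_cells p m xs) a m = weight f xs a m"
    using assms by (intro weight_cong) (auto simp: swap_cells_nth)
  then show ?thesis
    using assms by (auto simp: weight_Suc swap_cells_nth)
qed

text \<open>Addition with overflow: of the range \<open>{a..<m}\<close>, the two exchanges together
  alter only cell \<open>q\<close>, which receives the item of cell \<open>p\<close>.\<close>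

lemma weight_exchange:
  assumes "m \<le> p" "p < length xs" "a \<le> q" "q < m"
  shows "weight f (swap_cells q m (swap_cells p m xs)) a m
           = weight f xs a m + f (xs ! p) - f (xs ! q)"
  using assms
  by (subst weight_replace[where q = q and xs = xs]) (auto simp: swap_cells_nth)

section \<open>Tilings of the array by closed bins\<close>

text \<open>The latest bin is the head of the list, so the recursion runs from the right end
  \<open>e\<close> down to 0. Strictness of \<open>a < b\<close> makes every bin nonempty, on which
  distinctness of the bins and \<open>partition_on\<close> rely.\<close>

fun tiles :: "(nat \<times> nat) list \<Rightarrow> nat \<Rightarrow> bool" where
  "tiles [] e \<longleftrightarrow> e = 0"
| "tiles ((a, b) # cs) e \<longleftrightarrow> b = e \<and> a < b \<and> tiles cs a"

lemma tiles_bounds: "tiles cs e \<Longrightarrow> (a, b) \<in> set cs \<Longrightarrow> a < b \<and> b \<le> e"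
  by (induction cs e rule: tiles.induct) force+

lemma tiles_Union: "tiles cs e \<Longrightarrow> (\<Union>(a, b)\<in>set cs. {a..<b}) = {..<e}"
proof (induction cs e rule: tiles.induct)
  case (2 a b cs e)
  have "(\<Union>(a', b')\<in>set ((a, b) # cs). {a'..<b'}) = {a..<b} \<union> {..<a}"
    using 2 by simp
  also have "\<dots> = {..<e}" using 2(2) by auto
  finally show ?case .
qed simp

lemma tiles_disjoint:
  "tiles cs e \<Longrightarrow> (a, b) \<in> set cs \<Longrightarrow> (a', b') \<in> set cs \<Longrightarrow> (a, b) \<noteq> (a', b')
    \<Longrightarrow> {a..<b} \<inter> {a'..<b'} = {}"
proof (induction cs e rule: tiles.induct)
  case (2 a0 b0 cs e)
  note IH = "2.IH"
  have "y \<le> a0" if "(x, y) \<in> set cs" for x y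
    using 2(2) tiles_bounds[of cs a0 x y] that by simp
  then have *: "{x..<y} \<inter> {a0..<b0} = {}" "{a0..<b0} \<inter> {x..<y} = {}" if "(x, y) \<in> set cs" for x y
    using that by (fastforce simp: disjoint_iff)+
  consider "(a, b) = (a0, b0)" "(a', b') \<in> set cs" | "(a, b) \<in> set cs" "(a', b') = (a0, b0)"
    | "(a, b) \<in> set cs" "(a', b') \<in> set cs"
    using 2(3-5) by auto
  then show ?case
  proof cases
    case 1
    with *(2)[of a' b'] show ?thesis by simp
  next
    case 2
    with *(1)[of a b] show ?thesis by simp
  next
    case 3
    with \<open>tiles ((a0, b0) # cs) e\<close> \<open>(a, b) \<noteq> (a', b')\<close> show ?thesis
      by (intro IH) simp_all
  qed
qed simp

lemma tiles_distinct: "tiles cs e \<Longrightarrow> distinct cs"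
proof (induction cs e rule: tiles.induct)
  case (2 a b cs e)
  then show ?case using tiles_bounds[of cs a a b] by auto
qed simp

lemma weight_sum_tiles:
  "tiles cs e \<Longrightarrow> (\<Sum>(a, b)\<leftarrow>cs. weight f xs a b) = weight f xs 0 e"
proof (induction cs e rule: tiles.induct)
  case (2 a b cs e)
  have "weight f xs 0 a + weight f xs a b = weight f xs 0 b"
    unfolding weight_def using 2 by (intro sum.atLeastLessThan_concat) auto
  with 2 show ?case by simp
qed (simp add: weight_def)

section \<open>Lower bounds on the optimum\<close>

lemma sum_packing:
  assumes "packing n s l Bs"
  shows "sum f {..<n} = (\<Sum>B\<leftarrow>Bs. sum f B)"
proof -
  have "partition_on {..<n} (set Bs)" and d: "distinct Bs"
    using assms by (auto simp: packing_def)
  then have "sum f {..<n} = (\<Sum>B\<in>set Bs. sum f B)"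
    using sum.partition[of "{..<n}" "set Bs" f] by simp
  then show ?thesis using d by (simp add: sum_list_distinct_conv_sum_set)
qed

text \<open>Volume bound: each bin of an optimal packing takes at most 1 of either coordinate. The
  given packing shows that some packing exists, so the \<open>LEAST\<close> in
  \<open>min_bins\<close> is attained.\<close>

lemma sum_le_min_bins:
  assumes "packing n s l Bs"
  shows "sum s {..<n} \<le> min_bins n s l" "sum l {..<n} \<le> min_bins n s l"
proof -
  have "\<exists>k Bs. packing n s l Bs \<and> length Bs = k" using assms by blast
  then have "\<exists>Bs. packing n s l Bs \<and> length Bs = min_bins n s l"
    unfolding min_bins_def by (rule LeastI_ex)
  then obtain Os where Os: "packing n s l Os" "length Os = min_bins n s l" by blast
  have *: "sum f {..<n} \<le> length Os" if "\<And>B. B \<in> set Os \<Longrightarrow> sum f B \<le> 1" for f :: "nat \<Rightarrow> real"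
  proof -
    have "(\<Sum>B\<leftarrow>Os. sum f B) \<le> (\<Sum>B\<leftarrow>Os. 1)"
      using that by (intro sum_list_mono) auto
    then show ?thesis
      by (simp add: sum_packing[OF Os(1), of f] sum_list_triv)
  qed
  show "sum s {..<n} \<le> min_bins n s l" "sum l {..<n} \<le> min_bins n s l"
    using *[of s] *[of l] Os by (auto simp: packing_def)
qed

lemma max_weight_bounds: "i < n \<Longrightarrow> s i \<le> max_weight n s l \<and> l i \<le> max_weight n s l"
  unfolding max_weight_def by (auto intro!: Max_ge)

section \<open>Permuted arrays and properties of the closed bins\<close>

locale disks =
  fixes n :: nat and s l :: "nat \<Rightarrow> real"
  assumes valid: "valid_instance n s l"
begin

abbreviation "\<rho> \<equiv> max_weight n s l"

lemma item_bounds: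
  assumes "i < n"
  shows "0 \<le> s i" "0 \<le> l i" "s i \<le> 1" "l i \<le> 1" "s i \<le> \<rho>" "l i \<le> \<rho>"
  using valid assms max_weight_bounds[OF assms, of s l] by (auto simp: valid_instance_def)

text \<open>Equality of multisets is the form that exchanges preserve at once; length, distinctness
  and content are derived from it.\<close>

definition permuted :: "nat list \<Rightarrow> bool" where
  "permuted xs \<longleftrightarrow> mset xs = mset [0..<n]"

lemma permutedD:
  assumes "permuted xs"
  shows "length xs = n" "distinct xs" "set xs = {..<n}"
proof -
  have m: "mset xs = mset [0..<n]" using assms unfolding permuted_def .
  from mset_eq_length[OF m] show "length xs = n" by simp
  from mset_eq_imp_distinct_iff[OF m] show "distinct xs" by simp
  from mset_eq_setD[OF m] show "set xs = {..<n}" by (simp add: atLeast0LessThan)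
qed

lemma permuted_nth:
  assumes "permuted xs" "c < n"
  shows "xs ! c < n"
proof -
  have "xs ! c \<in> set xs" using assms permutedD(1)[OF assms(1)] by (intro nth_mem) simp
  then show ?thesis by (simp add: permutedD(3)[OF assms(1)])
qed

lemma permuted_swap: "permuted xs \<Longrightarrow> p < n \<Longrightarrow> q < n \<Longrightarrow> permuted (swap_cells p q xs)"
  using permutedD(1)[of xs] by (simp add: permuted_def mset_swap_cells)

definition feasible :: "nat list \<Rightarrow> (nat \<times> nat) list \<Rightarrow> bool" where
  "feasible xs cs \<longleftrightarrow> (\<forall>(a, b)\<in>set cs. weight s xs a b \<le> 1 \<and> weight l xs a b \<le> 1)"

definition full :: "(nat \<Rightarrow> real) \<Rightarrow> nat list \<Rightarrow> (nat \<times> nat) list \<Rightarrow> bool" where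
  "full f xs cs \<longleftrightarrow> (\<forall>(a, b)\<in>set cs. 1 - \<rho> \<le> weight f xs a b)"

text \<open>Here \<open>p\<close> and \<open>q\<close> stand for \<open>ptr_s\<close> and
  \<open>ptr_l\<close>. While both are below \<open>n\<close>, all closed bins are complete. Once
  \<open>p = n\<close>, the final packing fills the l-values and may give up s-completeness;
  symmetrically for \<open>q = n\<close>. The third conjunct keeps one coordinate full in all bins
  even when both pointers have reached \<open>n\<close>.\<close>

definition filled :: "nat list \<Rightarrow> nat \<Rightarrow> nat \<Rightarrow> (nat \<times> nat) list \<Rightarrow> bool" where
  "filled xs p q cs \<longleftrightarrow>
     (full s xs cs \<or> p = n) \<and> (full l xs cs \<or> q = n) \<and> (full s xs cs \<or> full l xs cs)"

lemma weight_cong_tiles: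
  assumes "tiles cs e" "\<And>c. c < e \<Longrightarrow> ys ! c = xs ! c" "(a, b) \<in> set cs"
  shows "weight f ys a b = weight f xs a b"
  using assms tiles_bounds[OF assms(1,3)] by (intro weight_cong) auto

text \<open>Closed bins are cell ranges of an array that keeps changing. Their properties persist
  because later exchanges leave the cells below \<open>e\<close> alone.\<close>

lemma
  assumes "tiles cs e" "\<And>c. c < e \<Longrightarrow> ys ! c = xs ! c"
  shows feasible_cong: "feasible ys cs = feasible xs cs"
    and filled_cong: "filled ys p q cs = filled xs p q cs"
proof -
  have w: "weight f ys (fst c) (snd c) = weight f xs (fst c) (snd c)" if "c \<in> set cs" for c f
    using weight_cong_tiles[OF assms, of "fst c" "snd c" f] that by simp
  show "feasible ys cs = feasible xs cs"
    unfolding feasible_def case_prod_unfold by (intro ball_cong refl) (simp add: w)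
  have "full f ys cs = full f xs cs" for f
    unfolding full_def case_prod_unfold by (intro ball_cong refl) (simp add: w)
  then show "filled ys p q cs = filled xs p q cs" by (simp add: filled_def)
qed

section \<open>Invariants of the modes and the potential\<close>

definition scan_inv :: "state \<Rightarrow> bool" where
  "scan_inv \<sigma> \<longleftrightarrow> arr \<sigma> = [0..<n] \<and> scan \<sigma> \<le> n \<and> free \<sigma> = 0 \<and> ptr_s \<sigma> = 0 \<and> ptr_l \<sigma> = 0 \<and>
     closed \<sigma> = [] \<and> 0 \<le> rho \<sigma> \<and> rho \<sigma> \<le> \<rho> \<and> (\<forall>i<scan \<sigma>. s i \<le> rho \<sigma> \<and> l i \<le> rho \<sigma>)"

text \<open>
  Here \<open>m\<close> is \<open>free \<sigma>\<close> for a bin under construction.  Between two bins it is one more, since an item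
  removed from the previous bin may have been put into the first unassigned cell, behind the
  pointer to its kind.
\<close>

definition ptr_inv :: "nat \<Rightarrow> state \<Rightarrow> bool" where
  "ptr_inv m \<sigma> \<longleftrightarrow> permuted (arr \<sigma>) \<and> rho \<sigma> = \<rho> \<and> ptr_s \<sigma> \<le> n \<and> ptr_l \<sigma> \<le> n \<and> free \<sigma> \<le> n \<and>
     (\<forall>c\<in>{m..<ptr_s \<sigma>}. \<not> s_heavy s l (arr \<sigma> ! c)) \<and> (\<forall>c\<in>{m..<ptr_l \<sigma>}. s_heavy s l (arr \<sigma> ! c))"

text \<open>The second alternative is for the final bin: when no item is left, the latest closed
  bin, dropped by \<open>tl\<close>, may be incomplete.\<close>

definition open_inv :: "state \<Rightarrow> bool" where
  "open_inv \<sigma> \<longleftrightarrow> ptr_inv (Suc (free \<sigma>)) \<sigma> \<and> tiles (closed \<sigma>) (free \<sigma>) \<and>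
     feasible (arr \<sigma>) (closed \<sigma>) \<and>
     (filled (arr \<sigma>) (ptr_s \<sigma>) (ptr_l \<sigma>) (closed \<sigma>) \<or>
      free \<sigma> = n \<and> filled (arr \<sigma>) (ptr_s \<sigma>) (ptr_l \<sigma>) (tl (closed \<sigma>)))"

text \<open>An s-heavy item opens the bin or, while l-heavy items remain, joins it at
  \<open>S < L\<close>; l-heavy items added later only lower \<open>S - L\<close>. The first
  alternative covers bins without s-heavy items, where \<open>last_s\<close> is stale. The case
  \<open>ptr_l \<sigma> = n\<close> covers the final packing, where s-heavy items are added
  regardless of balance, but no l-heavy item can cause an overflow any more.\<close>

definition balanced_s :: "state \<Rightarrow> bool" where
  "balanced_s \<sigma> \<longleftrightarrow> S_sum \<sigma> < L_sum \<sigma> \<or>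
     (first \<sigma> \<le> last_s \<sigma> \<and> last_s \<sigma> < free \<sigma> \<and>
      (ptr_l \<sigma> = n \<or>
       S_sum \<sigma> - s (arr \<sigma> ! last_s \<sigma>) \<le> L_sum \<sigma> - l (arr \<sigma> ! last_s \<sigma>)))"

definition balanced_l :: "state \<Rightarrow> bool" where
  "balanced_l \<sigma> \<longleftrightarrow> L_sum \<sigma> \<le> S_sum \<sigma> \<or>
     (first \<sigma> \<le> last_l \<sigma> \<and> last_l \<sigma> < free \<sigma> \<and>
      (ptr_s \<sigma> = n \<or>
       L_sum \<sigma> - l (arr \<sigma> ! last_l \<sigma>) \<le> S_sum \<sigma> - s (arr \<sigma> ! last_l \<sigma>)))"

definition bin_inv :: "state \<Rightarrow> bool" where
  "bin_inv \<sigma> \<longleftrightarrow> ptr_inv (free \<sigma>) \<sigma> \<and> tiles (closed \<sigma>) (first \<sigma>) \<and> feasible (arr \<sigma>) (closed \<sigma>) \<and>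
     filled (arr \<sigma>) (ptr_s \<sigma>) (ptr_l \<sigma>) (closed \<sigma>) \<and> first \<sigma> < free \<sigma> \<and>
     S_sum \<sigma> = weight s (arr \<sigma>) (first \<sigma>) (free \<sigma>) \<and> S_sum \<sigma> \<le> 1 \<and>
     L_sum \<sigma> = weight l (arr \<sigma>) (first \<sigma>) (free \<sigma>) \<and> L_sum \<sigma> \<le> 1 \<and>
     balanced_s \<sigma> \<and> balanced_l \<sigma>"

definition found_s :: "state \<Rightarrow> bool" where
  "found_s \<sigma> \<longleftrightarrow> ptr_s \<sigma> = n \<or> free \<sigma> \<le> ptr_s \<sigma> \<and> s_heavy s l (arr \<sigma> ! ptr_s \<sigma>)"

definition found_l :: "state \<Rightarrow> bool" where
  "found_l \<sigma> \<longleftrightarrow> ptr_l \<sigma> = n \<or> free \<sigma> \<le> ptr_l \<sigma> \<and> \<not> s_heavy s l (arr \<sigma> ! ptr_l \<sigma>)"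

text \<open>The bin exempted by \<open>tl\<close>, the last one closed, accounts for the
  \<open>+ 1\<close> in the approximation bound.\<close>

definition halted_inv :: "state \<Rightarrow> bool" where
  "halted_inv \<sigma> \<longleftrightarrow> permuted (arr \<sigma>) \<and> tiles (closed \<sigma>) n \<and> feasible (arr \<sigma>) (closed \<sigma>) \<and>
     (full s (arr \<sigma>) (tl (closed \<sigma>)) \<or> full l (arr \<sigma>) (tl (closed \<sigma>)))"

definition inv :: "state \<Rightarrow> bool" where
  "inv \<sigma> \<longleftrightarrow> (case mode \<sigma> of
       Scan \<Rightarrow> scan_inv \<sigma>
     | Open \<Rightarrow> open_inv \<sigma>
     | Advance_S \<Rightarrow> bin_inv \<sigma>
     | Advance_L \<Rightarrow> bin_inv \<sigma> \<and> found_s \<sigma>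
     | Pack \<Rightarrow> bin_inv \<sigma> \<and> found_s \<sigma> \<and> found_l \<sigma>
     | Halted \<Rightarrow> halted_inv \<sigma>)"

text \<open>
  Opening a bin and adding an item restart the two advances; the factor \<open>5\<close> pays for the resulting
  rise of the mode part from at least \<open>1\<close> to \<open>4\<close>.
\<close>

definition potential :: "state \<Rightarrow> nat" where
  "potential \<sigma> = (n - scan \<sigma>) + 5 * (n - free \<sigma>) + (n - ptr_s \<sigma>) + (n - ptr_l \<sigma>) +
     (case mode \<sigma> of Halted \<Rightarrow> 0 | Open \<Rightarrow> 1 | Scan \<Rightarrow> 2 | Pack \<Rightarrow> 2 | Advance_L \<Rightarrow> 3 | Advance_S \<Rightarrow> 4)"

definition progress :: "state \<Rightarrow> state \<Rightarrow> bool" where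
  "progress \<sigma> \<sigma>' \<longleftrightarrow> inv \<sigma>' \<and> potential \<sigma>' < potential \<sigma>"

section \<open>Scanning, opening a bin and advancing the pointers\<close>

lemma max_weight_nonneg: "0 \<le> \<rho>"
proof -
  have "0 < n" using valid by (simp add: valid_instance_def)
  from item_bounds(1)[OF this] item_bounds(5)[OF this] show ?thesis by linarith
qed

lemma scan_progress:
  assumes "scan_inv \<sigma>" "mode \<sigma> = Scan"
  shows "progress \<sigma> (scan_step n s l \<sigma>)"
proof (cases "scan \<sigma> < n")
  case True
  define r where "r = max (rho \<sigma>) (max (s (scan \<sigma>)) (l (scan \<sigma>)))"
  have r: "rho \<sigma> \<le> r" "s (scan \<sigma>) \<le> r" "l (scan \<sigma>) \<le> r" "r \<le> \<rho>"
    using assms item_bounds[OF True] by (auto simp: r_def scan_inv_def)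
  have "\<forall>i<scan \<sigma>. s i \<le> rho \<sigma> \<and> l i \<le> rho \<sigma>" "0 \<le> rho \<sigma>"
    using assms by (auto simp: scan_inv_def)
  then have "\<forall>i<Suc (scan \<sigma>). s i \<le> r \<and> l i \<le> r" "0 \<le> r"
    using r by (auto simp: less_Suc_eq intro: order_trans)
  moreover have "scan_step n s l \<sigma> = \<sigma>\<lparr>scan := Suc (scan \<sigma>), rho := r\<rparr>"
    using True assms by (simp add: scan_step_def scan_inv_def r_def Let_def)
  ultimately show ?thesis
    using True assms r(4)
    by (simp add: progress_def inv_def scan_inv_def potential_def)
next
  case False
  with assms have all: "\<forall>i<n. s i \<le> rho \<sigma> \<and> l i \<le> rho \<sigma>" by (simp add: scan_inv_def)
  have "0 < n" using valid by (simp add: valid_instance_def)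
  then have "\<rho> \<le> rho \<sigma>"
    using all unfolding max_weight_def by (intro Max.boundedI) auto
  then have "rho \<sigma> = \<rho>" using assms by (simp add: scan_inv_def)
  then have "open_inv (\<sigma>\<lparr>mode := Open\<rparr>)"
    using assms
    by (simp add: open_inv_def scan_inv_def ptr_inv_def permuted_def feasible_def filled_def full_def)
  with False assms show ?thesis
    by (simp add: progress_def inv_def scan_step_def potential_def)
qed

text \<open>The opening item comes from the first unassigned cell whatever its kind, so
  \<open>ptr_inv (Suc (free \<sigma>))\<close> becomes exactly the pointer invariant of the new bin.
  A single item is balanced: without it both sums are 0, and its own kind settles the other
  balance.\<close>

lemma open_progress:
  assumes inv: "open_inv \<sigma>" and mode: "mode \<sigma> = Open"
  shows "progress \<sigma> (open_step n s l \<sigma>)"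
proof (cases "free \<sigma> < n")
  case True
  define \<tau> where "\<tau> = open_step n s l \<sigma>"
  define i where "i = arr \<sigma> ! free \<sigma>"
  have "i < n" using inv True permuted_nth by (auto simp: open_inv_def ptr_inv_def i_def)
  note i = item_bounds[OF this]
  have "bin_inv \<tau>" "mode \<tau> = Advance_S" "free \<tau> = Suc (free \<sigma>)" "ptr_s \<tau> = ptr_s \<sigma>"
    "ptr_l \<tau> = ptr_l \<sigma>" "scan \<tau> = scan \<sigma>"
    using True inv i
    by (auto simp: \<tau>_def open_step_def Let_def bin_inv_def open_inv_def ptr_inv_def i_def
        balanced_s_def balanced_l_def weight_def s_heavy_def)
  then show ?thesis
    using True mode unfolding \<tau>_def by (simp add: progress_def inv_def potential_def)
next
  case False
  then have "free \<sigma> = n" using inv by (simp add: open_inv_def ptr_inv_def)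
  moreover have "full f (arr \<sigma>) (tl (closed \<sigma>))" if "full f (arr \<sigma>) (closed \<sigma>)" for f
    using that by (cases "closed \<sigma>") (auto simp: full_def)
  ultimately have "halted_inv (\<sigma>\<lparr>mode := Halted\<rparr>)"
    using inv by (auto simp: open_inv_def halted_inv_def ptr_inv_def filled_def)
  with False mode show ?thesis by (simp add: progress_def inv_def open_step_def potential_def)
qed

lemma bin_inv_mode [simp]: "bin_inv (\<sigma>\<lparr>mode := m\<rparr>) = bin_inv \<sigma>"
  by (simp add: bin_inv_def ptr_inv_def balanced_s_def balanced_l_def)

lemma found_mode [simp]:
  "found_s (\<sigma>\<lparr>mode := m\<rparr>) = found_s \<sigma>" "found_l (\<sigma>\<lparr>mode := m\<rparr>) = found_l \<sigma>"
  by (simp_all add: found_s_def found_l_def)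

text \<open>A cell that the pointer passes is assigned or holds an l-heavy item. As
  \<open>ptr_s \<sigma> < n\<close> before the move, \<open>filled\<close> already provides
  \<open>full s\<close>, so it survives the pointer reaching \<open>n\<close>.\<close>

lemma advance_s_progress:
  assumes inv: "bin_inv \<sigma>" and mode: "mode \<sigma> = Advance_S"
  shows "progress \<sigma> (advance_s_step n s l \<sigma>)"
proof (cases "ptr_s \<sigma> < n \<and> (ptr_s \<sigma> < free \<sigma> \<or> \<not> s_heavy s l (arr \<sigma> ! ptr_s \<sigma>))")
  case True
  then have "bin_inv (\<sigma>\<lparr>ptr_s := ptr_s \<sigma> + 1\<rparr>)"
    using inv by (auto simp: bin_inv_def ptr_inv_def filled_def balanced_s_def balanced_l_def less_Suc_eq)
  with True mode show ?thesis
    by (simp add: progress_def inv_def advance_s_step_def potential_def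
        Suc_diff_Suc[of "ptr_s \<sigma>" n, symmetric])
next
  case False
  then have "found_s \<sigma>" using inv by (auto simp: found_s_def bin_inv_def ptr_inv_def)
  moreover have "advance_s_step n s l \<sigma> = \<sigma>\<lparr>mode := Advance_L\<rparr>"
    unfolding advance_s_step_def using False by (simp only: if_False)
  ultimately show ?thesis
    using inv mode by (simp add: progress_def inv_def potential_def)
qed

lemma advance_l_progress:
  assumes inv: "bin_inv \<sigma>" "found_s \<sigma>" and mode: "mode \<sigma> = Advance_L"
  shows "progress \<sigma> (advance_l_step n s l \<sigma>)"
proof (cases "ptr_l \<sigma> < n \<and> (ptr_l \<sigma> < free \<sigma> \<or> s_heavy s l (arr \<sigma> ! ptr_l \<sigma>))")
  case True
  then have "bin_inv (\<sigma>\<lparr>ptr_l := ptr_l \<sigma> + 1\<rparr>)"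
    using inv by (auto simp: bin_inv_def ptr_inv_def filled_def balanced_s_def balanced_l_def less_Suc_eq)
  moreover have "found_s (\<sigma>\<lparr>ptr_l := ptr_l \<sigma> + 1\<rparr>)" using inv by (simp add: found_s_def)
  ultimately show ?thesis
    using True mode by (simp add: progress_def inv_def advance_l_step_def potential_def
        Suc_diff_Suc[of "ptr_l \<sigma>" n, symmetric])
next
  case False
  then have "found_l \<sigma>" using inv by (auto simp: found_l_def bin_inv_def ptr_inv_def)
  moreover have "advance_l_step n s l \<sigma> = \<sigma>\<lparr>mode := Pack\<rparr>"
    unfolding advance_l_step_def using False by (simp only: if_False)
  ultimately show ?thesis
    using inv mode by (simp add: progress_def inv_def potential_def)
qed

section \<open>Closing a bin and adding an item\<close>

text \<open>Completeness is stated through \<open>weight\<close> because after an overflow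
  \<open>S_sum\<close> and \<open>L_sum\<close> still count the removed item. A coordinate may fall
  short if its kind is exhausted while the other pointer is below \<open>n\<close>: by
  \<open>filled\<close>, all earlier bins are then full in the other coordinate, and the new bin
  continues this. With \<open>free \<sigma> = n\<close> the bin is the last one.\<close>

lemma close_bin_inv:
  assumes "ptr_inv (Suc (free \<sigma>)) \<sigma>" "tiles (closed \<sigma>) (first \<sigma>)" "feasible (arr \<sigma>) (closed \<sigma>)"
    and "first \<sigma> < free \<sigma>" "filled (arr \<sigma>) (ptr_s \<sigma>) (ptr_l \<sigma>) (closed \<sigma>)"
    and "weight s (arr \<sigma>) (first \<sigma>) (free \<sigma>) \<le> 1" "weight l (arr \<sigma>) (first \<sigma>) (free \<sigma>) \<le> 1"
    and "(1 - \<rho> \<le> weight s (arr \<sigma>) (first \<sigma>) (free \<sigma>) \<or> ptr_s \<sigma> = n \<and> ptr_l \<sigma> < n) \<and>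
         (1 - \<rho> \<le> weight l (arr \<sigma>) (first \<sigma>) (free \<sigma>) \<or> ptr_l \<sigma> = n \<and> ptr_s \<sigma> < n) \<or> free \<sigma> = n"
  shows "open_inv (close_bin \<sigma>)"
  using assms
  by (auto simp: open_inv_def close_bin_def ptr_inv_def feasible_def filled_def full_def)

lemma close_progress:
  assumes inv: "bin_inv \<sigma>" and mode: "mode \<sigma> = Pack"
    and "(1 - \<rho> \<le> S_sum \<sigma> \<or> ptr_s \<sigma> = n \<and> ptr_l \<sigma> < n) \<and>
         (1 - \<rho> \<le> L_sum \<sigma> \<or> ptr_l \<sigma> = n \<and> ptr_s \<sigma> < n) \<or> free \<sigma> = n"
  shows "progress \<sigma> (close_bin \<sigma>)"
proof -
  have "open_inv (close_bin \<sigma>)"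
    using assms by (intro close_bin_inv) (auto simp: bin_inv_def ptr_inv_def)
  then show ?thesis
    using mode by (simp add: progress_def inv_def potential_def close_bin_def)
qed

text \<open>The first three facts concern addition with overflow, the last three plain addition.
  Beyond cell \<open>m\<close> both act alike: cell \<open>p\<close> receives the former item of
  cell \<open>m\<close>.\<close>

lemma swap_behind_free:
  assumes "permuted xs" "m \<le> p" "p < n" "q \<le> m"
  shows "permuted (swap_cells q m (swap_cells p m xs))"
    and "\<And>c. m < c \<Longrightarrow> c < n \<Longrightarrow>
      swap_cells q m (swap_cells p m xs) ! c = (if c = p then xs ! m else xs ! c)"
    and "\<And>c. c < q \<Longrightarrow> swap_cells q m (swap_cells p m xs) ! c = xs ! c"
    and "permuted (swap_cells p m xs)"
    and "\<And>c. m < c \<Longrightarrow> c < n \<Longrightarrow>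
      swap_cells p m xs ! c = (if c = p then xs ! m else xs ! c)"
    and "\<And>c. c < m \<Longrightarrow> swap_cells p m xs ! c = xs ! c"
proof -
  show "permuted (swap_cells p m xs)" "permuted (swap_cells q m (swap_cells p m xs))"
    using assms by (simp_all add: permuted_swap)
qed (use assms permutedD(1)[OF assms(1)] in \<open>simp_all add: swap_cells_nth\<close>)

text \<open>If \<open>p\<close> lies beyond \<open>free \<sigma>\<close> and behind a pointer, then
  cell \<open>free \<sigma>\<close> is behind that pointer too, so the item moved from there to
  \<open>p\<close> has the right kind.\<close>

lemma ptr_inv_swap:
  assumes "ptr_inv (free \<sigma>) \<sigma>"
    and "\<And>c. free \<sigma> < c \<Longrightarrow> c < n \<Longrightarrow> ys ! c = (if c = p then arr \<sigma> ! free \<sigma> else arr \<sigma> ! c)"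
  shows "\<forall>c\<in>{Suc (free \<sigma>)..<ptr_s \<sigma>}. \<not> s_heavy s l (ys ! c)"
    and "\<forall>c\<in>{Suc (free \<sigma>)..<ptr_l \<sigma>}. s_heavy s l (ys ! c)"
proof -
  have *: "P (ys ! c)"
    if "\<forall>c\<in>{free \<sigma>..<m}. P (arr \<sigma> ! c)" "c \<in> {Suc (free \<sigma>)..<m}" "m \<le> n" for P m c
    using that assms(2)[of c] by simp
  show "\<forall>c\<in>{Suc (free \<sigma>)..<ptr_s \<sigma>}. \<not> s_heavy s l (ys ! c)"
    using assms(1) *[of "ptr_s \<sigma>" "\<lambda>i. \<not> s_heavy s l i"] by (simp add: ptr_inv_def)
  show "\<forall>c\<in>{Suc (free \<sigma>)..<ptr_l \<sigma>}. s_heavy s l (ys ! c)"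
    using assms(1) *[of "ptr_l \<sigma>" "s_heavy s l"] by (simp add: ptr_inv_def)
qed

text \<open>No item weighs more than \<open>\<rho>\<close>, so \<open>light\<close> excludes an
  overflow of \<open>L\<close>. The alternatives of \<open>cond\<close> are the main loop and the
  final packing; they are what the new \<open>balanced_l\<close> asks of the sums before the
  addition.\<close>

lemma add_l_progress:
  assumes inv: "bin_inv \<sigma>" "found_s \<sigma>" "found_l \<sigma>" and mode: "mode \<sigma> = Pack"
    and ptr: "ptr_l \<sigma> < n" and light: "L_sum \<sigma> < 1 - \<rho>"
    and cond: "L_sum \<sigma> \<le> S_sum \<sigma> \<or> ptr_s \<sigma> = n"
  shows "progress \<sigma> (add_l s l \<sigma>)"
proof -
  define p where "p = ptr_l \<sigma>"
  define i where "i = arr \<sigma> ! p"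
  define xs where "xs = swap_cells p (free \<sigma>) (arr \<sigma>)"
  have ptrs: "ptr_inv (free \<sigma>) \<sigma>" and bal: "balanced_s \<sigma>" "balanced_l \<sigma>"
    using inv(1) by (simp_all add: bin_inv_def)
  then have bounds: "rho \<sigma> = \<rho>" "ptr_s \<sigma> \<le> n" "ptr_l \<sigma> \<le> n"
    by (simp_all add: ptr_inv_def)
  have perm: "permuted (arr \<sigma>)" and bin: "first \<sigma> < free \<sigma>" "tiles (closed \<sigma>) (first \<sigma>)"
    "feasible (arr \<sigma>) (closed \<sigma>)" "filled (arr \<sigma>) (ptr_s \<sigma>) (ptr_l \<sigma>) (closed \<sigma>)"
    and S: "weight s (arr \<sigma>) (first \<sigma>) (free \<sigma>) = S_sum \<sigma>"
    and L: "weight l (arr \<sigma>) (first \<sigma>) (free \<sigma>) = L_sum \<sigma>"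
    using inv by (auto simp: bin_inv_def ptr_inv_def)
  have p: "free \<sigma> \<le> p" "p < n" "\<not> s_heavy s l i"
    using inv ptr by (auto simp: found_l_def p_def i_def)
  have "i < n" using permuted_nth perm p by (simp add: i_def)
  note i = item_bounds[OF this]
  have len: "length (arr \<sigma>) = n" using permutedD perm by simp
  have L_le: "L_sum \<sigma> + l i \<le> 1" using light i by linarith
  show ?thesis
  proof (cases "S_sum \<sigma> + s i > 1")
    case False
    define \<tau> where "\<tau> = add_l s l \<sigma>"
    have \<tau>: "\<tau> = \<sigma>\<lparr>arr := xs, S_sum := S_sum \<sigma> + s i, L_sum := L_sum \<sigma> + l i,
        last_l := free \<sigma>, free := free \<sigma> + 1, mode := Advance_S\<rparr>"
      using False by (simp add: \<tau>_def add_l_def Let_def xs_def p_def i_def)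
    have xs: "permuted xs" "\<And>c. free \<sigma> < c \<Longrightarrow> c < n \<Longrightarrow> xs ! c = (if c = p then arr \<sigma> ! free \<sigma> else arr \<sigma> ! c)"
      "\<And>c. c < free \<sigma> \<Longrightarrow> xs ! c = arr \<sigma> ! c"
      using swap_behind_free(4-6)[OF perm p(1,2) order_refl] by (auto simp: xs_def)
    have "ptr_inv (free \<tau>) \<tau>"
      using xs(1) ptr_inv_swap[OF ptrs xs(2)] bounds p by (simp add: \<tau> ptr_inv_def)
    moreover have "feasible xs (closed \<sigma>)" "filled xs (ptr_s \<sigma>) (ptr_l \<sigma>) (closed \<sigma>)"
      using bin xs(3) by (auto simp: feasible_cong[OF bin(2), of xs "arr \<sigma>"] filled_cong[OF bin(2), of xs "arr \<sigma>"])
    moreover have "weight f xs (first \<sigma>) (Suc (free \<sigma>)) = weight f (arr \<sigma>) (first \<sigma>) (free \<sigma>) + f i" for f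
      unfolding xs_def i_def using p bin len by (intro weight_add) auto
    moreover have "xs ! free \<sigma> = i" using p len by (simp add: xs_def swap_cells_nth i_def)
    \<comment> \<open>Cells below \<open>free \<sigma>\<close> are unchanged, so
      \<open>last_s\<close> still names the same item, and the l-heavy \<open>i\<close> lowers
      \<open>S - L\<close>. For \<open>balanced_l\<close> the removable item is \<open>i\<close>
      itself.\<close>
    then have "balanced_s \<tau>" "balanced_l \<tau>"
      using bal p bin cond xs(3) by (auto simp: \<tau> balanced_s_def balanced_l_def s_heavy_def)
    ultimately have "bin_inv \<tau>"
      using False L_le S L bin by (simp add: bin_inv_def \<tau>)
    moreover have "potential \<tau> < potential \<sigma>" using p mode by (simp add: \<tau> potential_def)
    ultimately show ?thesis unfolding progress_def inv_def \<tau>_def[symmetric] by (simp add: \<tau>)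
  next
    case True
    define q where "q = last_s \<sigma>"
    define j where "j = arr \<sigma> ! q"
    define ys where "ys = swap_cells q (free \<sigma>) xs"
    define \<tau> where "\<tau> = \<sigma>\<lparr>S_sum := S_sum \<sigma> + s i, L_sum := L_sum \<sigma> + l i, arr := ys\<rparr>"
    have add: "add_l s l \<sigma> = close_bin \<tau>"
      using True by (simp add: \<tau>_def add_l_def Let_def xs_def ys_def p_def q_def i_def)
    \<comment> \<open>The overflow puts \<open>S\<close> above \<open>1 - \<rho>\<close> and thus
      above \<open>L\<close>. This excludes the first alternative of \<open>balanced_s\<close>, and
      \<open>ptr_l \<sigma> < n\<close> selects the inequality for the removable item
      \<open>j\<close>.\<close>
    have "1 - \<rho> < S_sum \<sigma>" using True i by linarith
    then have "L_sum \<sigma> \<le> S_sum \<sigma>" using light by linarith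
    then have q: "first \<sigma> \<le> q" "q < free \<sigma>" and diff: "S_sum \<sigma> - s j \<le> L_sum \<sigma> - l j"
      using bal ptr by (auto simp: balanced_s_def q_def j_def)
    have "j < n" using permuted_nth perm q p by (simp add: j_def)
    note j = item_bounds[OF this]
    have ys: "permuted ys" "\<And>c. free \<sigma> < c \<Longrightarrow> c < n \<Longrightarrow> ys ! c = (if c = p then arr \<sigma> ! free \<sigma> else arr \<sigma> ! c)"
      "\<And>c. c < first \<sigma> \<Longrightarrow> ys ! c = arr \<sigma> ! c"
      using swap_behind_free(1-3)[OF perm p(1,2), of q] q by (auto simp: xs_def ys_def)
    have w: "weight f ys (first \<sigma>) (free \<sigma>) = weight f (arr \<sigma>) (first \<sigma>) (free \<sigma>) + f i - f j" for f
      unfolding ys_def xs_def i_def j_def using p q len by (intro weight_exchange) auto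
    have "ptr_inv (Suc (free \<tau>)) \<tau>"
      using ys(1) ptr_inv_swap[OF ptrs ys(2)] bounds p by (simp add: \<tau>_def ptr_inv_def)
    moreover have "feasible ys (closed \<sigma>)" "filled ys (ptr_s \<sigma>) (ptr_l \<sigma>) (closed \<sigma>)"
      using bin ys(3) by (auto simp: feasible_cong[OF bin(2), of ys "arr \<sigma>"] filled_cong[OF bin(2), of ys "arr \<sigma>"])
    \<comment> \<open>From a sum above 1 at most \<open>\<rho>\<close> is removed;
      \<open>diff\<close> and l-heaviness of \<open>i\<close> give the comparison; \<open>L\<close>
      was at most 1 even before \<open>j\<close> left.\<close>
    moreover have "1 - \<rho> \<le> weight s ys (first \<sigma>) (free \<sigma>)"
      "weight s ys (first \<sigma>) (free \<sigma>) \<le> weight l ys (first \<sigma>) (free \<sigma>)"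
      "weight l ys (first \<sigma>) (free \<sigma>) \<le> 1"
      using w[of s] w[of l] S L True j diff p(3) L_le by (auto simp: s_heavy_def)
    ultimately have "open_inv (close_bin \<tau>)"
      using bin by (intro close_bin_inv) (auto simp: \<tau>_def)
    \<comment> \<open>Since \<open>free\<close> does not move here, the potential drops by the mode
      part alone, from 2 for \<open>Pack\<close> to 1 for \<open>Open\<close>.\<close>
    then show ?thesis
      using mode unfolding add by (simp add: progress_def inv_def potential_def close_bin_def \<tau>_def)
  qed
qed

text \<open>Mirror image of \<open>add_l_progress\<close>; since ties count as s-heavy, strict and
  weak inequalities trade places.\<close>

lemma add_s_progress:
  assumes inv: "bin_inv \<sigma>" "found_s \<sigma>" "found_l \<sigma>" and mode: "mode \<sigma> = Pack"
    and ptr: "ptr_s \<sigma> < n" and light: "S_sum \<sigma> < 1 - \<rho>"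
    and cond: "S_sum \<sigma> < L_sum \<sigma> \<or> ptr_l \<sigma> = n"
  shows "progress \<sigma> (add_s s l \<sigma>)"
proof -
  define p where "p = ptr_s \<sigma>"
  define i where "i = arr \<sigma> ! p"
  define xs where "xs = swap_cells p (free \<sigma>) (arr \<sigma>)"
  have ptrs: "ptr_inv (free \<sigma>) \<sigma>" and bal: "balanced_s \<sigma>" "balanced_l \<sigma>"
    using inv(1) by (simp_all add: bin_inv_def)
  then have bounds: "rho \<sigma> = \<rho>" "ptr_s \<sigma> \<le> n" "ptr_l \<sigma> \<le> n"
    by (simp_all add: ptr_inv_def)
  have perm: "permuted (arr \<sigma>)" and bin: "first \<sigma> < free \<sigma>" "tiles (closed \<sigma>) (first \<sigma>)"
    "feasible (arr \<sigma>) (closed \<sigma>)" "filled (arr \<sigma>) (ptr_s \<sigma>) (ptr_l \<sigma>) (closed \<sigma>)"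
    and S: "weight s (arr \<sigma>) (first \<sigma>) (free \<sigma>) = S_sum \<sigma>"
    and L: "weight l (arr \<sigma>) (first \<sigma>) (free \<sigma>) = L_sum \<sigma>"
    using inv by (auto simp: bin_inv_def ptr_inv_def)
  have p: "free \<sigma> \<le> p" "p < n" "s_heavy s l i"
    using inv ptr by (auto simp: found_s_def p_def i_def)
  have "i < n" using permuted_nth perm p by (simp add: i_def)
  note i = item_bounds[OF this]
  have len: "length (arr \<sigma>) = n" using permutedD perm by simp
  have S_le: "S_sum \<sigma> + s i \<le> 1" using light i by linarith
  show ?thesis
  proof (cases "L_sum \<sigma> + l i > 1")
    case False
    define \<tau> where "\<tau> = add_s s l \<sigma>"
    have \<tau>: "\<tau> = \<sigma>\<lparr>arr := xs, S_sum := S_sum \<sigma> + s i, L_sum := L_sum \<sigma> + l i,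
        last_s := free \<sigma>, free := free \<sigma> + 1, mode := Advance_S\<rparr>"
      using False by (simp add: \<tau>_def add_s_def Let_def xs_def p_def i_def)
    have xs: "permuted xs" "\<And>c. free \<sigma> < c \<Longrightarrow> c < n \<Longrightarrow> xs ! c = (if c = p then arr \<sigma> ! free \<sigma> else arr \<sigma> ! c)"
      "\<And>c. c < free \<sigma> \<Longrightarrow> xs ! c = arr \<sigma> ! c"
      using swap_behind_free(4-6)[OF perm p(1,2) order_refl] by (auto simp: xs_def)
    have "ptr_inv (free \<tau>) \<tau>"
      using xs(1) ptr_inv_swap[OF ptrs xs(2)] bounds p by (simp add: \<tau> ptr_inv_def)
    moreover have "feasible xs (closed \<sigma>)" "filled xs (ptr_s \<sigma>) (ptr_l \<sigma>) (closed \<sigma>)"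
      using bin xs(3) by (auto simp: feasible_cong[OF bin(2), of xs "arr \<sigma>"] filled_cong[OF bin(2), of xs "arr \<sigma>"])
    moreover have "weight f xs (first \<sigma>) (Suc (free \<sigma>)) = weight f (arr \<sigma>) (first \<sigma>) (free \<sigma>) + f i" for f
      unfolding xs_def i_def using p bin len by (intro weight_add) auto
    moreover have "xs ! free \<sigma> = i" using p len by (simp add: xs_def swap_cells_nth i_def)
    then have "balanced_s \<tau>" "balanced_l \<tau>"
      using bal p bin cond xs(3) by (auto simp: \<tau> balanced_s_def balanced_l_def s_heavy_def)
    ultimately have "bin_inv \<tau>"
      using False S_le S L bin by (simp add: bin_inv_def \<tau>)
    moreover have "potential \<tau> < potential \<sigma>" using p mode by (simp add: \<tau> potential_def)
    ultimately show ?thesis unfolding progress_def inv_def \<tau>_def[symmetric] by (simp add: \<tau>)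
  next
    case True
    define q where "q = last_l \<sigma>"
    define j where "j = arr \<sigma> ! q"
    define ys where "ys = swap_cells q (free \<sigma>) xs"
    define \<tau> where "\<tau> = \<sigma>\<lparr>S_sum := S_sum \<sigma> + s i, L_sum := L_sum \<sigma> + l i, arr := ys\<rparr>"
    have add: "add_s s l \<sigma> = close_bin \<tau>"
      using True by (simp add: \<tau>_def add_s_def Let_def xs_def ys_def p_def q_def i_def)
    have "1 - \<rho> < L_sum \<sigma>" using True i by linarith
    then have "S_sum \<sigma> < L_sum \<sigma>" using light by linarith
    then have q: "first \<sigma> \<le> q" "q < free \<sigma>" and diff: "L_sum \<sigma> - l j \<le> S_sum \<sigma> - s j"
      using bal ptr by (auto simp: balanced_l_def q_def j_def)
    have "j < n" using permuted_nth perm q p by (simp add: j_def)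
    note j = item_bounds[OF this]
    have ys: "permuted ys" "\<And>c. free \<sigma> < c \<Longrightarrow> c < n \<Longrightarrow> ys ! c = (if c = p then arr \<sigma> ! free \<sigma> else arr \<sigma> ! c)"
      "\<And>c. c < first \<sigma> \<Longrightarrow> ys ! c = arr \<sigma> ! c"
      using swap_behind_free(1-3)[OF perm p(1,2), of q] q by (auto simp: xs_def ys_def)
    have w: "weight f ys (first \<sigma>) (free \<sigma>) = weight f (arr \<sigma>) (first \<sigma>) (free \<sigma>) + f i - f j" for f
      unfolding ys_def xs_def i_def j_def using p q len by (intro weight_exchange) auto
    have "ptr_inv (Suc (free \<tau>)) \<tau>"
      using ys(1) ptr_inv_swap[OF ptrs ys(2)] bounds p by (simp add: \<tau>_def ptr_inv_def)
    moreover have "feasible ys (closed \<sigma>)" "filled ys (ptr_s \<sigma>) (ptr_l \<sigma>) (closed \<sigma>)"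
      using bin ys(3) by (auto simp: feasible_cong[OF bin(2), of ys "arr \<sigma>"] filled_cong[OF bin(2), of ys "arr \<sigma>"])
    moreover have "1 - \<rho> \<le> weight l ys (first \<sigma>) (free \<sigma>)"
      "weight l ys (first \<sigma>) (free \<sigma>) \<le> weight s ys (first \<sigma>) (free \<sigma>)"
      "weight s ys (first \<sigma>) (free \<sigma>) \<le> 1"
      using w[of s] w[of l] S L True j diff p(3) S_le by (auto simp: s_heavy_def)
    ultimately have "open_inv (close_bin \<tau>)"
      using bin by (intro close_bin_inv) (auto simp: \<tau>_def)
    then show ?thesis
      using mode unfolding add by (simp add: progress_def inv_def potential_def close_bin_def \<tau>_def)
  qed
qed

text \<open>In the main loop an incomplete bin falls short in its lighter coordinate, the one about
  to be filled; in the final packing the test before each addition yields the same bound. So the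
  premise \<open>light\<close> is available for every addition.\<close>

lemma pack_progress:
  assumes inv: "bin_inv \<sigma>" "found_s \<sigma>" "found_l \<sigma>" and mode: "mode \<sigma> = Pack"
  shows "progress \<sigma> (pack_step n s l \<sigma>)"
proof -
  have rho: "rho \<sigma> = \<rho>" and ptr: "ptr_s \<sigma> \<le> n" "ptr_l \<sigma> \<le> n" and free: "free \<sigma> \<le> n"
    using inv by (auto simp: bin_inv_def ptr_inv_def)
  \<comment> \<open>Otherwise the item in cell \<open>free \<sigma>\<close> would be s-heavy and
    l-heavy at once.\<close>
  have exhausted: "free \<sigma> = n" if "ptr_s \<sigma> = n" "ptr_l \<sigma> = n"
  proof (rule ccontr)
    assume "free \<sigma> \<noteq> n"
    with free that inv(1) show False
      unfolding bin_inv_def ptr_inv_def by (metis atLeastLessThan_iff le_neq_implies_less order_refl)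
  qed
  note close = close_progress[OF inv(1) mode]
    and add_s = add_s_progress[OF inv mode] and add_l = add_l_progress[OF inv mode]
  show ?thesis
  proof (cases "1 - \<rho> \<le> S_sum \<sigma> \<and> 1 - \<rho> \<le> L_sum \<sigma>")
    case True
    then have "pack_step n s l \<sigma> = close_bin \<sigma>" by (simp add: pack_step_def rho)
    with True close show ?thesis by simp
  next
    case False
    note step = pack_step_def[of n s l \<sigma>, unfolded rho if_not_P[OF False]]
    consider "ptr_s \<sigma> < n" "ptr_l \<sigma> < n" | "ptr_s \<sigma> < n" "ptr_l \<sigma> = n"
      | "ptr_s \<sigma> = n" "ptr_l \<sigma> < n" | "ptr_s \<sigma> = n" "ptr_l \<sigma> = n"
      using ptr le_neq_implies_less by blast
    then show ?thesis
    proof cases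
      case 1
      show ?thesis
      proof (cases "L_sum \<sigma> \<le> S_sum \<sigma>")
        case True
        with False have "L_sum \<sigma> < 1 - \<rho>" by linarith
        with 1 True add_l show ?thesis by (simp add: step)
      next
        case heavy_l: False
        with False have "S_sum \<sigma> < 1 - \<rho>" by linarith
        with 1 heavy_l add_s show ?thesis by (simp add: step)
      qed
    next
      case 2
      with close add_s show ?thesis by (cases "1 - \<rho> \<le> S_sum \<sigma>") (simp_all add: step)
    next
      case 3
      with close add_l show ?thesis by (cases "1 - \<rho> \<le> L_sum \<sigma>") (simp_all add: step)
    next
      case 4
      with close exhausted show ?thesis by (simp add: step)
    qed
  qed
qed

section \<open>Termination within the initial potential\<close>

lemma step_progress:
  assumes "inv \<sigma>" "mode \<sigma> \<noteq> Halted"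
  shows "progress \<sigma> (step n s l \<sigma>)"
  using assms scan_progress open_progress advance_s_progress advance_l_progress pack_progress
  by (cases "mode \<sigma>") (auto simp: inv_def step_def)

lemma halts:
  assumes "inv \<sigma>"
  shows "\<exists>t\<le>potential \<sigma>. mode ((step n s l ^^ t) \<sigma>) = Halted \<and> inv ((step n s l ^^ t) \<sigma>)"
  using assms
proof (induction "potential \<sigma>" arbitrary: \<sigma> rule: less_induct)
  case less
  show ?case
  proof (cases "mode \<sigma> = Halted")
    case True
    with less.prems show ?thesis by (intro exI[of _ 0]) auto
  next
    case False
    with less.prems have pr: "inv (step n s l \<sigma>)" "potential (step n s l \<sigma>) < potential \<sigma>"
      using step_progress by (auto simp: progress_def)
    from less.hyps[OF pr(2,1)] obtain t where
      "t \<le> potential (step n s l \<sigma>)" "mode ((step n s l ^^ t) (step n s l \<sigma>)) = Halted"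
      "inv ((step n s l ^^ t) (step n s l \<sigma>))" by blast
    with pr(2) show ?thesis
      by (intro exI[of _ "Suc t"]) (simp add: funpow_Suc_right del: funpow.simps)
  qed
qed

lemma initial_inv: "inv (initial_state n)"
  by (simp add: inv_def initial_state_def scan_inv_def max_weight_nonneg)

lemma initial_potential: "potential (initial_state n) = 8 * n + 2"
  by (simp add: potential_def initial_state_def)

section \<open>From the halting state to the approximation bound\<close>

text \<open>The final array is a bijection from cells to items, so it carries the tiling of the
  cells to a partition of the items.\<close>

lemma halted_packing:
  assumes "halted_inv \<sigma>"
  shows "packing n s l (bins_of \<sigma>)"
proof -
  define B where "B = (\<lambda>(a, b). (!) (arr \<sigma>) ` {a..<b})"
  have perm: "permuted (arr \<sigma>)" and tiles: "tiles (closed \<sigma>) n" and feas: "feasible (arr \<sigma>) (closed \<sigma>)"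
    using assms by (auto simp: halted_inv_def)
  have inj: "inj_on ((!) (arr \<sigma>)) {..<n}"
    using permutedD[OF perm] by (simp add: inj_on_nth)
  have img: "(!) (arr \<sigma>) ` {..<n} = {..<n}"
    using permutedD[OF perm] by (auto simp: set_conv_nth image_def)
  have sub: "{a..<b} \<subseteq> {..<n}" "a < b" if "(a, b) \<in> set (closed \<sigma>)" for a b
    using tiles_bounds[OF tiles that] by auto
  have bins: "bins_of \<sigma> = map B (rev (closed \<sigma>))" by (simp add: bins_of_def B_def)
  have disj: "B c \<inter> B c' = {}" if "c \<in> set (closed \<sigma>)" "c' \<in> set (closed \<sigma>)" "c \<noteq> c'" for c c'
  proof -
    obtain a b a' b' where c: "c = (a, b)" "c' = (a', b')" by (cases c, cases c')
    have "{a..<b} \<inter> {a'..<b'} = {}" using tiles_disjoint[OF tiles] that c by auto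
    then show ?thesis
      using inj_on_image_Int[OF inj, of "{a..<b}" "{a'..<b'}"] sub that c by (auto simp: B_def)
  qed
  have nonempty: "B c \<noteq> {}" if "c \<in> set (closed \<sigma>)" for c
    using sub that by (cases c) (auto simp: B_def)
  \<comment> \<open>Different cell ranges with the same image would give a bin disjoint from itself,
    hence empty.\<close>
  have "inj_on B (set (closed \<sigma>))"
    using disj nonempty by (intro inj_onI) (metis inf.idem)
  then have "distinct (bins_of \<sigma>)"
    using tiles_distinct[OF tiles] by (simp add: bins distinct_map)
  moreover have "partition_on {..<n} (set (bins_of \<sigma>))"
  proof (rule partition_onI)
    have "(\<Union>(a, b)\<in>set (closed \<sigma>). (!) (arr \<sigma>) ` {a..<b}) = (!) (arr \<sigma>) ` (\<Union>(a, b)\<in>set (closed \<sigma>). {a..<b})"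
      by auto
    also have "\<dots> = {..<n}" by (simp add: tiles_Union[OF tiles] img)
    finally show "\<Union> (set (bins_of \<sigma>)) = {..<n}" by (simp add: bins B_def)
    show "disjnt p q" if pq: "p \<in> set (bins_of \<sigma>)" "q \<in> set (bins_of \<sigma>)" "p \<noteq> q" for p q
    proof -
      obtain c c' where "p = B c" "q = B c'" "c \<in> set (closed \<sigma>)" "c' \<in> set (closed \<sigma>)"
        using pq(1,2) by (auto simp: bins)
      with pq(3) disj[of c c'] show ?thesis by (auto simp: disjnt_def)
    qed
    show "{} \<notin> set (bins_of \<sigma>)"
      using nonempty by (auto simp: bins)
  qed
  moreover have "sum f (B (a, b)) = weight f (arr \<sigma>) a b" if "(a, b) \<in> set (closed \<sigma>)" for f a b
    using inj_on_subset[OF inj sub(1)[OF that]]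
    by (simp add: B_def weight_def sum.reindex)
  then have "\<forall>B\<in>set (bins_of \<sigma>). sum s B \<le> 1 \<and> sum l B \<le> 1"
    using feas by (auto simp: bins feasible_def)
  ultimately show ?thesis by (simp add: packing_def)
qed

lemma full_count:
  assumes perm: "permuted (arr \<sigma>)" and tiles: "tiles (closed \<sigma>) n"
    and full: "full f (arr \<sigma>) (tl (closed \<sigma>))" and nonneg: "\<And>i. i < n \<Longrightarrow> 0 \<le> f i"
  shows "(real (length (closed \<sigma>)) - 1) * (1 - \<rho>) \<le> sum f {..<n} \<or> closed \<sigma> = []"
proof (cases "closed \<sigma>")
  case (Cons c cs)
  obtain a b where c: "c = (a, b)" by (cases c)
  have bound: "a < b" "b \<le> n" using tiles_bounds[OF tiles, of a b] Cons c by auto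
  have "(\<Sum>(a, b)\<leftarrow>cs. 1 - \<rho>) \<le> (\<Sum>(a, b)\<leftarrow>cs. weight f (arr \<sigma>) a b)"
    using full Cons by (intro sum_list_mono) (auto simp: full_def)
  moreover have "(\<Sum>(a, b)\<leftarrow>cs. 1 - \<rho>) = length cs * (1 - \<rho>)"
    by (simp add: case_prod_unfold sum_list_triv)
  \<comment> \<open>The last bin is credited with weight 0 only, whence the \<open>- 1\<close> in
    the count.\<close>
  moreover have "0 \<le> weight f (arr \<sigma>) a b"
    unfolding weight_def using bound permuted_nth[OF perm] nonneg by (intro sum_nonneg) auto
  ultimately have "length cs * (1 - \<rho>) \<le> (\<Sum>(a, b)\<leftarrow>closed \<sigma>. weight f (arr \<sigma>) a b)"
    using Cons c by simp
  also have "\<dots> = (\<Sum>c<n. f (arr \<sigma> ! c))"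
    using weight_sum_tiles[OF tiles, of f "arr \<sigma>"] by (simp add: weight_def atLeast0LessThan)
  also have "\<dots> = sum f {..<n}"
  proof -
    have "bij_betw ((!) (arr \<sigma>)) {..<n} {..<n}"
      using permutedD[OF perm] by (intro bij_betw_nth) auto
    then show ?thesis by (rule sum.reindex_bij_betw)
  qed
  finally show ?thesis using Cons by simp
qed simp

text \<open>Whichever coordinate is full in all bins but the last, its total weight is at most the
  optimum, so the maximum of both totals serves for either case.\<close>

lemma halted_bound:
  assumes inv: "halted_inv \<sigma>" and lt: "\<rho> < 1"
  shows "real (length (bins_of \<sigma>)) \<le> real (min_bins n s l) / (1 - \<rho>) + 1"
proof -
  have "(real (length (closed \<sigma>)) - 1) * (1 - \<rho>) \<le> max (sum s {..<n}) (sum l {..<n}) \<or> closed \<sigma> = []"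
    using inv full_count[of \<sigma> s] full_count[of \<sigma> l] item_bounds by (auto simp: halted_inv_def)
  then have "(real (length (closed \<sigma>)) - 1) * (1 - \<rho>) \<le> min_bins n s l \<or> closed \<sigma> = []"
    using sum_le_min_bins[OF halted_packing[OF inv]] by linarith
  then have "real (length (closed \<sigma>)) - 1 \<le> min_bins n s l / (1 - \<rho>) \<or> closed \<sigma> = []"
    using lt by (simp add: pos_le_divide_eq)
  moreover have "0 \<le> min_bins n s l / (1 - \<rho>)" using lt by simp
  ultimately show ?thesis by (auto simp: bins_of_def)
qed

end

theorem theorem1:
  shows "\<exists>T :: nat \<Rightarrow> real. T \<in> O(\<lambda>n. real n) \<and>
    (\<forall>n s l. valid_instance n s l \<longrightarrow>
      (\<exists>t. real t \<le> T n \<and>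
        mode (pack_disks_run n s l t) = Halted \<and>
        packing n s l (bins_of (pack_disks_run n s l t)) \<and>
        (max_weight n s l < 1 \<longrightarrow>
          real (length (bins_of (pack_disks_run n s l t)))
            \<le> real (min_bins n s l) / (1 - max_weight n s l) + 1)))"
\<comment> \<open>The time bound is the potential of the initial state.\<close>
proof (rule exI[of _ "\<lambda>n. 8 * real n + 2"], intro conjI allI impI)
  show "(\<lambda>n. 8 * real n + 2) \<in> O(\<lambda>n. real n)"
    \<comment> \<open>For \<open>n \<ge> 1\<close>, \<open>8 * n + 2 \<le> 10 * n\<close>.\<close>
    by (intro bigoI[of _ 10] eventually_sequentiallyI[of 1]) auto
next
  fix n s l assume "valid_instance n s l"
  then interpret disks n s l by (rule disks.intro)
  obtain t where t: "t \<le> 8 * n + 2" "mode (pack_disks_run n s l t) = Halted"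
      "inv (pack_disks_run n s l t)"
    using halts[OF initial_inv] unfolding initial_potential pack_disks_run_def by blast
  then have "halted_inv (pack_disks_run n s l t)" by (simp add: inv_def)
  note final = halted_packing[OF this] halted_bound[OF this]
  have "real t \<le> 8 * real n + 2" using t(1) by linarith
  with t(2) final show "\<exists>t. real t \<le> 8 * real n + 2 \<and>
        mode (pack_disks_run n s l t) = Halted \<and>
        packing n s l (bins_of (pack_disks_run n s l t)) \<and>
        (max_weight n s l < 1 \<longrightarrow>
          real (length (bins_of (pack_disks_run n s l t)))
            \<le> real (min_bins n s l) / (1 - max_weight n s l) + 1)" by blast
qed

end
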